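(* Let $N\ge 1$ be an integer and let $\mathcal{K}$ be a simplicial complex in $\mathbb{R}^N$. Then the underlying space $|\mathcal{K}|$ is a Hausdorff space.
   Context: Points $\mathbf{a}_0,\ldots,\mathbf{a}_n$ of $\mathbb{R}^N$ are geometrically independent if for all real scalars $t_i$, the equations $\sum_i t_i=0$ and $\sum_i t_i\mathbf{a}_i=\mathbf{0}$ imply $t_i=0$ for all $i$. The simplex spanned by such points (its vertices) is $\{\sum_{i=0}^n t_i\mathbf{a}_i : t_i\ge 0,\ \sum_i t_i=1\}$, with the subspace topology from $\mathbb{R}^N$. A face of a simplex is a simplex spanned by a non-empty subset of its vertices (possibly all of them). A simplicial complex in $\mathbb{R}^N$ is a non-empty, possibly infinite, collection $\mathcal{K}$ of simplices in $\mathbb{R}^N$ such that every face of a simplex of $\mathcal{K}$ is in $\mathcal{K}$, and for all $\sigma,\tau\in\mathcal{K}$ the intersection $\sigma\cap\tau$ is either empty or a face of both. The underlying space is $|\mathcal{K}|=\bigcup_{\sigma\in\mathcal{K}}\sigma$, with the topology in which $U\subset|\mathcal{K}|$ is open if and only if $U\cap\sigma$ is open in $\sigma$ for every $\sigma\in\mathcal{K}$. *)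

theory Defs
  imports "HOL-Analysis.Analysis"
begin

text \<open>A geometrically independent family has pairwise distinct members, so vertices are
  collected in a finite set and the coefficients are indexed by the vertices themselves.\<close>

definition geom_independent :: "(real ^ 'n) set \<Rightarrow> bool" where
  "geom_independent A \<longleftrightarrow> finite A \<and>
     (\<forall>t. (\<Sum>a\<in>A. t a) = 0 \<and> (\<Sum>a\<in>A. t a *\<^sub>R a) = 0 \<longrightarrow> (\<forall>a\<in>A. t a = 0))"

definition spanned_simplex :: "(real ^ 'n) set \<Rightarrow> (real ^ 'n) set" where
  "spanned_simplex A =
     {x. \<exists>t. (\<forall>a\<in>A. 0 \<le> t a) \<and> (\<Sum>a\<in>A. t a) = 1 \<and> x = (\<Sum>a\<in>A. t a *\<^sub>R a)}"

definition vertex_set_of :: "(real ^ 'n) set \<Rightarrow> (real ^ 'n) set \<Rightarrow> bool" where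
  "vertex_set_of A \<sigma> \<longleftrightarrow> A \<noteq> {} \<and> geom_independent A \<and> \<sigma> = spanned_simplex A"

definition is_simplex :: "(real ^ 'n) set \<Rightarrow> bool" where
  "is_simplex \<sigma> \<longleftrightarrow> (\<exists>A. vertex_set_of A \<sigma>)"

definition simplex_face :: "(real ^ 'n) set \<Rightarrow> (real ^ 'n) set \<Rightarrow> bool" where
  "simplex_face \<tau> \<sigma> \<longleftrightarrow>
     (\<exists>A B. vertex_set_of A \<sigma> \<and> B \<subseteq> A \<and> B \<noteq> {} \<and> \<tau> = spanned_simplex B)"

text \<open>The library constant \<open>simplicial_complex\<close> requires finiteness and counts the empty set
  as a face, so it is not the notion meant here.\<close>

definition geom_complex :: "(real ^ 'n) set set \<Rightarrow> bool" where
  "geom_complex K \<longleftrightarrow>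
     K \<noteq> {} \<and>
     (\<forall>\<sigma>\<in>K. is_simplex \<sigma>) \<and>
     (\<forall>\<sigma>\<in>K. \<forall>\<tau>. simplex_face \<tau> \<sigma> \<longrightarrow> \<tau> \<in> K) \<and>
     (\<forall>\<sigma>\<in>K. \<forall>\<tau>\<in>K. \<sigma> \<inter> \<tau> = {} \<or> (simplex_face (\<sigma> \<inter> \<tau>) \<sigma> \<and> simplex_face (\<sigma> \<inter> \<tau>) \<tau>))"

text \<open>The underlying space is the coherent topology on the union of the simplices; in general
  it is finer than the subspace topology inherited from the ambient Euclidean space.\<close>

definition underlying_space :: "(real ^ 'n) set set \<Rightarrow> (real ^ 'n) topology" where
  "underlying_space K =
     topology (\<lambda>U. U \<subseteq> \<Union>K \<and> (\<forall>\<sigma>\<in>K. openin (top_of_set \<sigma>) (U \<inter> \<sigma>)))"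

lemma openin_underlying_space:
  "openin (underlying_space K) U \<longleftrightarrow>
     U \<subseteq> \<Union>K \<and> (\<forall>\<sigma>\<in>K. openin (top_of_set \<sigma>) (U \<inter> \<sigma>))"
proof -
  let ?P = "\<lambda>U. U \<subseteq> \<Union>K \<and> (\<forall>\<sigma>\<in>K. openin (top_of_set \<sigma>) (U \<inter> \<sigma>))"
  have "?P (S \<inter> T)" if S: "?P S" and T: "?P T" for S T
  proof (intro conjI ballI)
    show "S \<inter> T \<subseteq> \<Union>K" using S by (simp add: le_infI1)
    fix \<sigma>
    assume "\<sigma> \<in> K"
    with S T have "openin (top_of_set \<sigma>) ((S \<inter> \<sigma>) \<inter> (T \<inter> \<sigma>))"
      by (simp add: openin_Int)
    moreover have "(S \<inter> \<sigma>) \<inter> (T \<inter> \<sigma>) = S \<inter> T \<inter> \<sigma>" by auto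
    ultimately show "openin (top_of_set \<sigma>) (S \<inter> T \<inter> \<sigma>)" by simp
  qed
  moreover have "?P (\<Union>\<U>)" if \<U>: "\<forall>U\<in>\<U>. ?P U" for \<U>
  proof (intro conjI ballI)
    show "\<Union>\<U> \<subseteq> \<Union>K" using \<U> by (simp add: Sup_le_iff)
    fix \<sigma>
    assume "\<sigma> \<in> K"
    with \<U> have "openin (top_of_set \<sigma>) (\<Union>((\<lambda>U. U \<inter> \<sigma>) ` \<U>))"
      by (intro openin_Union) auto
    moreover have "\<Union>((\<lambda>U. U \<inter> \<sigma>) ` \<U>) = \<Union>\<U> \<inter> \<sigma>" by auto
    ultimately show "openin (top_of_set \<sigma>) (\<Union>\<U> \<inter> \<sigma>)" by simp
  qed
  ultimately have "istopology ?P"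
    unfolding istopology_def by (intro conjI allI impI) simp_all
  then show ?thesis
    by (simp add: underlying_space_def topology_inverse')
qed

lemma topspace_underlying_space: "topspace (underlying_space K) = \<Union>K"
proof
  show "topspace (underlying_space K) \<subseteq> \<Union>K"
    using openin_topspace[of "underlying_space K"] by (simp only: openin_underlying_space)
  have "openin (top_of_set \<sigma>) (\<Union>K \<inter> \<sigma>)" if "\<sigma> \<in> K" for \<sigma>
  proof -
    have "\<Union>K \<inter> \<sigma> = \<sigma>" using that by blast
    then show ?thesis by simp
  qed
  then show "\<Union>K \<subseteq> topspace (underlying_space K)"
    by (simp add: openin_subset openin_underlying_space)
qed

end

theory Submission
  imports Defs
begin

text \<open>The coherent topology on \<open>\<Union>K\<close> is at least as fine as the subspace
  topology from Euclidean space, and the Hausdorff property passes to finer topologies.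
  \<open>openin_underlying_space_Int_open\<close> provides the comparison.\<close>

text \<open>Coherent openness is tested simplex by simplex, and an ambient open set meets each
  simplex in a relatively open set.\<close>

lemma openin_underlying_space_Int_open:
  assumes "open S"
  shows "openin (underlying_space K) (\<Union>K \<inter> S)"
  unfolding openin_underlying_space
proof (intro conjI ballI)
  fix \<sigma> assume "\<sigma> \<in> K"
  then have "\<Union>K \<inter> S \<inter> \<sigma> = \<sigma> \<inter> S" by blast
  with assms show "openin (top_of_set \<sigma>) (\<Union>K \<inter> S \<inter> \<sigma>)"
    by (simp add: openin_open_Int)
qed simp

theorem lemma4p19:
  fixes K :: "(real ^ 'n) set set"
  assumes "geom_complex K"
  shows "Hausdorff_space (underlying_space K)"
  unfolding Hausdorff_space_def topspace_underlying_space
proof (intro allI impI)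
  fix x y
  assume xy: "x \<in> \<Union>K \<and> y \<in> \<Union>K \<and> x \<noteq> y"
  \<comment> \<open>The points are separated in \<open>real ^ 'n\<close>; the traces of
    \<open>S\<close> and \<open>T\<close> on \<open>\<Union>K\<close> are the required
    neighbourhoods.\<close>
  then obtain S T where "open S" "open T" and ST: "x \<in> S" "y \<in> T" "S \<inter> T = {}"
    using hausdorff[of x y] by blast
  then have "openin (underlying_space K) (\<Union>K \<inter> S)" "openin (underlying_space K) (\<Union>K \<inter> T)"
    by (simp_all add: openin_underlying_space_Int_open)
  moreover have "x \<in> \<Union>K \<inter> S" "y \<in> \<Union>K \<inter> T" "disjnt (\<Union>K \<inter> S) (\<Union>K \<inter> T)"
    using xy ST by (auto simp: disjnt_def)
  ultimately show "\<exists>U V. openin (underlying_space K) U \<and> openin (underlying_space K) V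
      \<and> x \<in> U \<and> y \<in> V \<and> disjnt U V"
    by blast
qed

end
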